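(* Let $d\ge 1$ and $n\ge 1$ be integers and let $\mu$ be a positive Borel measure on $\mathbb{R}^d$ having convergent moments up to at least degree $n$, i.e., every real polynomial in $d$ variables of total degree at most $n$ is absolutely integrable with respect to $\mu$. Then there exists a quadrature rule for $\mu$ of degree $n-1$ with size $\le 1+N_{n-1,d;\mu}$. That is, writing $K=\operatorname{supp}\mu$, there exist $N\le 1+N_{n-1,d;\mu}$, points $x_1,\dots,x_N\in K$, and positive real numbers $\rho_1,\dots,\rho_N$ such that $$\int p(t)\,d\mu(t)=\sum_{k=1}^{N}\rho_k\,p(x_k)\qquad\text{for all } p\in\mathbb{R}_{n-1,d}[t].$$
   Context: $\mathbb{R}_{m,d}[t]=\mathbb{R}_m[t_1,\dots,t_d]$ is the space of real polynomials of total degree at most $m$ in $t_1,\dots,t_d$. $\operatorname{supp}\mu$ denotes the closed support of $\mu$. $N_{m,d;\mu}:=\dim\{p|_{\operatorname{supp}\mu}: p\in\mathbb{R}_{m,d}[t]\}$. A quadrature rule for $\mu$ of degree (precision) $m$ and size $N<\infty$ consists of nodes $x_1,\dots,x_N\in\operatorname{supp}\mu$ and positive weights $\rho_1,\dots,\rho_N$ with $\int p\,d\mu=\sum_{k=1}^N\rho_k p(x_k)$ for all $p\in\mathbb{R}_{m,d}[t]$ (for the zero measure, the empty rule $N=0$ is allowed). *)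

theory Defs
  imports "HOL-Analysis.Analysis" "HOL-Library.Function_Algebras"
begin

definition monomial_fun :: "('d::finite \<Rightarrow> nat) \<Rightarrow> real ^ 'd \<Rightarrow> real" where
  "monomial_fun a t = (\<Prod>i\<in>UNIV. (t $ i) ^ a i)"

text \<open>Real polynomials of total degree at most m, as functions on the whole space; since the
  reals are infinite, this loses nothing compared with formal polynomials.\<close>

definition polys_upto :: "nat \<Rightarrow> (real ^ 'd::finite \<Rightarrow> real) set" where
  "polys_upto m = {p. \<exists>c. p = (\<lambda>t. \<Sum>a | sum a UNIV \<le> m. c a * monomial_fun a t)}"

definition closed_support :: "'a::topological_space measure \<Rightarrow> 'a set" where
  "closed_support M = {x. \<forall>U. open U \<and> x \<in> U \<longrightarrow> emeasure M U > 0}"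

interpretation real_fun: vector_space "\<lambda>(c::real) (f::'a \<Rightarrow> real) x. c * f x"
  by unfold_locales (auto simp: fun_eq_iff algebra_simps)

text \<open>A restriction to K is represented by its extension by zero outside K (not by the library's
  restriction, whose default value outside K would not be respected by addition and scaling), so
  that the restrictions form a linear subspace isomorphic to the space of functions on K.\<close>

definition restriction_dim :: "nat \<Rightarrow> (real ^ 'd::finite) measure \<Rightarrow> nat" where
  "restriction_dim m M =
     real_fun.dim ((\<lambda>p x. if x \<in> closed_support M then p x else 0) ` polys_upto m)"

text \<open>Integrability is demanded explicitly because the Bochner integral of a non-integrable
  function is 0 by convention.\<close>

definition quadrature_rule ::
    "(real ^ 'd::finite) measure \<Rightarrow> nat \<Rightarrow> nat \<Rightarrow> (nat \<Rightarrow> real ^ 'd) \<Rightarrow> (nat \<Rightarrow> real) \<Rightarrow> bool" where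
  "quadrature_rule M m N x \<rho> \<longleftrightarrow>
     (\<forall>k\<in>{1..N}. x k \<in> closed_support M \<and> \<rho> k > 0) \<and>
     (\<forall>p\<in>polys_upto m. integrable M p \<and> (\<integral>t. p t \<partial>M) = (\<Sum>k=1..N. \<rho> k * p (x k)))"

end

(* Choose a basis B of the space of restrictions. Centre its members to have mean zero; the claim
   is then that 0 is a convex combination of values of the B-tuple on K. If not, a nonzero linear
   functional is nonnegative on all these values. It has integral zero, so it vanishes almost
   everywhere; discarding a null set makes one basis function a combination of the others, and one
   inducts on the number of functions. Caratheodory's theorem then bounds the number of nodes.
   Since the number of functions is a term and not a type, the separation theorem is proved
   directly for functions on a finite index set. *)
theory Submission
  imports Defs
begin

section \<open>Compactness and separation for real functions on an index set\<close>

text \<open>Tychonoff's theorem: the box is a product of compact intervals, in the product topology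
  that the function type carries. The index type may be infinite, so Heine-Borel does not
  apply.\<close>

lemma compact_box_fun:
  fixes l u :: "'i \<Rightarrow> real"
  shows "compact {w. \<forall>i. l i \<le> w i \<and> w i \<le> u i}"
proof -
  have "compactin (product_topology (\<lambda>_. euclideanreal) UNIV) (PiE UNIV (\<lambda>i. {l i..u i}))"
    by (subst compactin_PiE) auto
  moreover have "PiE UNIV (\<lambda>i. {l i..u i}) = {w. \<forall>i. l i \<le> w i \<and> w i \<le> u i}"
    by (auto simp: PiE_def Pi_def)
  ultimately show ?thesis
    by (simp add: euclidean_product_topology)
qed

lemma continuous_on_linear_fun:
  fixes c :: "'i \<Rightarrow> real"
  shows "continuous_on A (\<lambda>w. \<Sum>i\<in>S. w i * c i)"
  by (intro continuous_intros continuous_on_subset[OF continuous_on_product_coordinates]) auto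

text \<open>A closed slice of a compact box. Weights are pinned to 0 outside \<open>S\<close>, since
  free coordinates there would destroy compactness.\<close>

lemma compact_simplex_fun:
  fixes S :: "'i set"
  assumes "finite S"
  shows "compact {w :: 'i \<Rightarrow> real. (\<forall>i\<in>S. 0 \<le> w i) \<and> (\<forall>i. i \<notin> S \<longrightarrow> w i = 0) \<and> sum w S = 1}"
    (is "compact ?D")
proof -
  define B where "B = {w. \<forall>i. 0 \<le> w i \<and> w i \<le> (if i \<in> S then 1 else (0::real))}"
  have "compact B"
    unfolding B_def by (rule compact_box_fun)
  \<comment> \<open>The factor 1 puts the sum into the shape of
    \<open>continuous_on_linear_fun\<close>.\<close>
  moreover have "closed {w :: 'i \<Rightarrow> real. (\<Sum>i\<in>S. w i * 1) = 1}"
    by (intro closed_Collect_eq continuous_on_linear_fun continuous_intros)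
  moreover have "w i \<le> 1" if "\<forall>i\<in>S. 0 \<le> w i" "sum w S = 1" "i \<in> S" for w :: "'i \<Rightarrow> real" and i
    using that assms member_le_sum[of i S w] by auto
  then have "?D = B \<inter> {w. (\<Sum>i\<in>S. w i * 1) = 1}"
    unfolding B_def by (auto split: if_splits) (metis antisym)
  ultimately show ?thesis
    by (simp add: compact_Int_closed)
qed

text \<open>The separating functional is the point of least norm of the convex hull.\<close>

lemma strict_separation_finite:
  fixes g :: "'i \<Rightarrow> 'x \<Rightarrow> real"
  assumes S: "finite S" and I: "finite I"
    and no: "\<And>w. (\<forall>x\<in>S. 0 \<le> w x) \<Longrightarrow> sum w S = 1 \<Longrightarrow> \<exists>i\<in>I. (\<Sum>x\<in>S. w x * g i x) \<noteq> 0"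
  obtains a where "\<forall>x\<in>S. 0 < (\<Sum>i\<in>I. a i * g i x)"
proof (cases "S = {}")
  case True
  then show ?thesis using that by auto
next
  case False
  define D where
    "D = {w :: 'x \<Rightarrow> real. (\<forall>x\<in>S. 0 \<le> w x) \<and> (\<forall>x. x \<notin> S \<longrightarrow> w x = 0) \<and> sum w S = 1}"
  define v where "v w i = (\<Sum>x\<in>S. w x * g i x)" for w i
  define q where "q w = (\<Sum>i\<in>I. (v w i)\<^sup>2)" for w
  have "compact D"
    unfolding D_def using S by (rule compact_simplex_fun)
  moreover have "D \<noteq> {}"
  proof -
    obtain x where "x \<in> S" using False by auto
    then have "(\<lambda>y. if y = x then 1 else 0) \<in> D"
      using S by (auto simp: D_def)
    then show ?thesis by auto
  qed
  moreover have "continuous_on D q"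
    unfolding q_def v_def by (intro continuous_on_sum continuous_on_power continuous_on_linear_fun)
  ultimately obtain w where w: "w \<in> D" and min: "\<And>w'. w' \<in> D \<Longrightarrow> q w \<le> q w'"
    using continuous_attains_inf by metis
  have "q w > 0"
  proof -
    obtain i where "i \<in> I" "v w i \<noteq> 0"
      using no[of w] w by (auto simp: D_def v_def)
    then show ?thesis
      unfolding q_def using I by (intro sum_pos2[of _ i]) auto
  qed
  have "0 < (\<Sum>i\<in>I. v w i * g i x)" if x: "x \<in> S" for x
  proof (rule ccontr)
    define C where "C = (\<Sum>i\<in>I. v w i * g i x)"
    define B where "B = (\<Sum>i\<in>I. (g i x)\<^sup>2)"
    assume "\<not> 0 < (\<Sum>i\<in>I. v w i * g i x)"
    then have C: "C \<le> 0" by (simp add: C_def)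
    have B: "B \<ge> 0" by (simp add: B_def sum_nonneg)
    \<comment> \<open>On the segment from \<open>w\<close> to the vertex at \<open>x\<close>, the
      cross term is at most 0 because \<open>C \<le> 0\<close>. This \<open>t\<close> minimises the
      remaining bound \<open>(1 - t)\<^sup>2 * q w + t\<^sup>2 * B\<close>, whose value there is
      \<open>q w - t * q w\<close>, below the supposed minimum.\<close>
    define t where "t = q w / (q w + B)"
    have t: "0 < t" "t \<le> 1" "t * (q w + B) = q w"
      using \<open>q w > 0\<close> B by (auto simp: t_def)
    define w' where "w' y = (1 - t) * w y + t * (if y = x then 1 else 0)" for y
    have "w' \<in> D"
      using w t x S by (auto simp: D_def w'_def sum.distrib simp flip: sum_distrib_left)
    have v': "v w' i = (1 - t) * v w i + t * g i x" for i
    proof -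
      have "v w' i = (\<Sum>y\<in>S. (1 - t) * (w y * g i y) + (if y = x then t * g i x else 0))"
        unfolding v_def w'_def by (intro sum.cong) (auto simp: algebra_simps)
      then show ?thesis
        using x S by (simp add: sum.distrib v_def sum_distrib_left)
    qed
    have "q w' = (1 - t)\<^sup>2 * q w + 2 * t * (1 - t) * C + t\<^sup>2 * B"
      unfolding q_def v' C_def B_def sum_distrib_left sum.distrib[symmetric]
      by (intro sum.cong) (auto simp: power2_eq_square algebra_simps)
    also have "\<dots> \<le> (1 - t)\<^sup>2 * q w + t\<^sup>2 * B"
      using t C by (simp add: mult_nonneg_nonpos)
    also have "\<dots> = q w - 2 * t * q w + t * (t * (q w + B))"
      by (simp add: power2_eq_square algebra_simps)
    also have "\<dots> = q w - t * q w"
      by (simp add: t(3))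
    also have "\<dots> < q w"
      using t \<open>q w > 0\<close> by simp
    finally show False
      using min[OF \<open>w' \<in> D\<close>] by simp
  qed
  then show ?thesis using that by blast
qed

text \<open>The unit functionals nonnegative at a given point form a compact set, which reduces the claim to
  finite subsets of \<open>K\<close>.\<close>

lemma weak_separation:
  fixes g :: "'i \<Rightarrow> 'x \<Rightarrow> real"
  assumes I: "finite I"
    and no: "\<And>S w. finite S \<Longrightarrow> S \<subseteq> K \<Longrightarrow> (\<forall>x\<in>S. 0 \<le> w x) \<Longrightarrow> sum w S = 1 \<Longrightarrow>
      \<exists>i\<in>I. (\<Sum>x\<in>S. w x * g i x) \<noteq> 0"
    and "K \<noteq> {}"
  obtains a where "\<exists>i\<in>I. a i \<noteq> 0" "\<forall>x\<in>K. 0 \<le> (\<Sum>i\<in>I. a i * g i x)"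
proof -
  \<comment> \<open>\<open>Sph\<close> is the unit sphere in the coordinates from \<open>I\<close>.
    The box fixes all other coordinates at 0, which makes the sphere compact.\<close>
  define B where "B = {a. \<forall>i. (if i \<in> I then - 1 else 0) \<le> a i \<and> a i \<le> (if i \<in> I then 1 else (0::real))}"
  define Sph where "Sph = B \<inter> {a. (\<Sum>i\<in>I. (a i)\<^sup>2) = 1}"
  define H where "H x = {a. 0 \<le> (\<Sum>i\<in>I. a i * g i x)}" for x
  have "closed {a :: 'i \<Rightarrow> real. (\<Sum>i\<in>I. (a i)\<^sup>2) = 1}"
    by (intro closed_Collect_eq continuous_intros continuous_on_product_coordinates)
  then have compact: "compact Sph"
    unfolding Sph_def B_def using compact_box_fun by (intro compact_Int_closed)
  have closed: "closed (H x)" for x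
    unfolding H_def by (intro closed_Collect_le continuous_on_linear_fun continuous_intros)
  have fip: "Sph \<inter> (\<Inter>x\<in>S. H x) \<noteq> {}" if S: "finite S" "S \<subseteq> K" for S
  proof -
    \<comment> \<open>Adding a point of \<open>K\<close> covers the case of empty \<open>S\<close>:
      strict positivity at \<open>x0\<close> is what forces the functional to be nonzero, so that it
      can be normalised.\<close>
    obtain x0 where "x0 \<in> K" using \<open>K \<noteq> {}\<close> by auto
    have "\<exists>i\<in>I. (\<Sum>x\<in>insert x0 S. w x * g i x) \<noteq> 0"
      if "\<forall>x\<in>insert x0 S. 0 \<le> w x" "sum w (insert x0 S) = 1" for w
      using no[of "insert x0 S" w] that S \<open>x0 \<in> K\<close> by auto
    then obtain a where a: "\<forall>x\<in>insert x0 S. 0 < (\<Sum>i\<in>I. a i * g i x)"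
      using S by (auto intro: strict_separation_finite[OF _ I, of "insert x0 S" g])
    define r where "r = sqrt (\<Sum>i\<in>I. (a i)\<^sup>2)"
    have "\<exists>i\<in>I. a i \<noteq> 0"
    proof (rule ccontr)
      assume "\<not> ?thesis"
      then have "(\<Sum>i\<in>I. a i * g i x0) = 0" by simp
      then show False using a by simp
    qed
    then obtain i where "i \<in> I" "a i \<noteq> 0" by auto
    then have sq: "(\<Sum>i\<in>I. (a i)\<^sup>2) > 0"
      using I by (intro sum_pos2[of _ i]) auto
    then have r: "r > 0" "r\<^sup>2 = (\<Sum>i\<in>I. (a i)\<^sup>2)"
      by (auto simp: r_def)
    define b where "b i = (if i \<in> I then a i / r else 0)" for i
    have b1: "(\<Sum>i\<in>I. (b i)\<^sup>2) = 1"
      using r sq by (simp add: b_def power_divide sum_divide_distrib[symmetric])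
    have "\<bar>b i\<bar> \<le> 1" if "i \<in> I" for i
      using member_le_sum[of i I "\<lambda>i. (b i)\<^sup>2"] that I b1 abs_square_le_1[of "b i"] by auto
    then have "- 1 \<le> b i \<and> b i \<le> 1" if "i \<in> I" for i
      using that by (auto simp: abs_le_iff minus_le_iff)
    moreover have "b i = 0" if "i \<notin> I" for i
      using that by (simp add: b_def)
    ultimately have "b \<in> Sph"
      using b1 by (auto simp: Sph_def B_def)
    moreover have "b \<in> H x" if "x \<in> S" for x
    proof -
      have "(\<Sum>i\<in>I. b i * g i x) = (\<Sum>i\<in>I. a i * g i x) / r"
        by (simp add: b_def sum_divide_distrib)
      then show ?thesis
        using a that r by (simp add: H_def less_imp_le)
    qed
    ultimately show ?thesis by auto
  qed
  have "Sph \<inter> (\<Inter>x\<in>K. H x) \<noteq> {}"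
    using compact closed fip by (rule compact_imp_fip_image)
  then obtain a where a: "a \<in> Sph" "\<forall>x\<in>K. a \<in> H x" by blast
  have "\<exists>i\<in>I. a i \<noteq> 0"
  proof (rule ccontr)
    assume "\<not> ?thesis"
    then have "(\<Sum>i\<in>I. (a i)\<^sup>2) = 0" by simp
    then show False using a(1) by (simp add: Sph_def)
  qed
  moreover have "\<forall>x\<in>K. 0 \<le> (\<Sum>i\<in>I. a i * g i x)"
    using a(2) by (simp add: H_def)
  ultimately show ?thesis by (rule that)
qed

section \<open>From zero means to convex combinations\<close>

text \<open>\<open>K\<close> is any set containing almost every point, not the support itself, so
  that the induction can shrink it to the zero set of the separating functional. The last assumption
  says that \<open>M\<close> is not the zero measure, which keeps every such set nonempty.\<close>

lemma zero_mean_imp_convex_combination: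
  fixes g :: "'i \<Rightarrow> 'x \<Rightarrow> real"
  assumes "finite I"
    and "\<And>i. i \<in> I \<Longrightarrow> integrable M (g i)" "\<And>i. i \<in> I \<Longrightarrow> (\<integral>x. g i x \<partial>M) = 0"
    and "AE x in M. x \<in> K" and "\<not> (AE x in M. False)"
  shows "\<exists>S w. finite S \<and> S \<subseteq> K \<and> (\<forall>x\<in>S. 0 \<le> w x) \<and> sum w S = (1::real) \<and>
    (\<forall>i\<in>I. (\<Sum>x\<in>S. w x * g i x) = 0)"
  using assms(1-4)
proof (induction "card I" arbitrary: I K)
  case 0
  then have "K \<noteq> {}" using assms(5) by auto
  then obtain x where "x \<in> K" by auto
  with 0 show ?case by (intro exI[of _ "{x}"] exI[of _ "\<lambda>_. 1"]) auto
next
  case (Suc n)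
  show ?case
  proof (rule ccontr)
    assume neg: "\<not> ?case"
    have "K \<noteq> {}" using Suc.prems assms(5) by auto
    have no: "\<exists>i\<in>I. (\<Sum>x\<in>S. w x * g i x) \<noteq> 0"
      if "finite S" "S \<subseteq> K" "\<forall>x\<in>S. 0 \<le> w x" "sum w S = 1" for S w
      using neg that by blast
    obtain a where a: "\<exists>i\<in>I. a i \<noteq> 0" "\<forall>x\<in>K. 0 \<le> (\<Sum>i\<in>I. a i * g i x)"
      using weak_separation[OF \<open>finite I\<close> no \<open>K \<noteq> {}\<close>] by blast
    then obtain j where j: "j \<in> I" "a j \<noteq> 0" by auto
    define h where "h x = (\<Sum>i\<in>I. a i * g i x)" for x
    have "integrable M h" "(\<integral>x. h x \<partial>M) = 0"
      unfolding h_def using Suc.prems by (auto simp: Bochner_Integration.integral_sum)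
    moreover have "AE x in M. 0 \<le> h x"
      using Suc.prems(4) by eventually_elim (use a in \<open>auto simp: h_def\<close>)
    ultimately have "AE x in M. h x = 0"
      using integral_nonneg_eq_0_iff_AE by blast
    with Suc.prems(4) have "AE x in M. x \<in> {x \<in> K. h x = 0}"
      by eventually_elim auto
    moreover have "n = card (I - {j})"
      using Suc.hyps(2) j Suc.prems(1) by simp
    ultimately obtain S w where S: "finite S" "S \<subseteq> {x \<in> K. h x = 0}"
      and w: "\<forall>x\<in>S. 0 \<le> w x" "sum w S = 1"
      and eq: "\<forall>i\<in>I - {j}. (\<Sum>x\<in>S. w x * g i x) = 0"
      using Suc.hyps(1)[of "I - {j}" "{x \<in> K. h x = 0}"] Suc.prems by auto
    \<comment> \<open>On \<open>S\<close> the linear relation \<open>h x = 0\<close> holds exactly,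
      and \<open>a j \<noteq> 0\<close>; it therefore carries the vanishing of the other sums over
      to the index \<open>j\<close> that was dropped.\<close>
    have "0 = (\<Sum>x\<in>S. w x * h x)"
      using S by (intro sum.neutral[symmetric]) auto
    also have "\<dots> = (\<Sum>i\<in>I. a i * (\<Sum>x\<in>S. w x * g i x))"
      unfolding h_def sum_distrib_left by (subst sum.swap) (simp add: mult.left_commute)
    also have "\<dots> = a j * (\<Sum>x\<in>S. w x * g j x)"
      using eq j Suc.prems(1) by (subst sum.remove[of I j]) auto
    finally have "(\<Sum>x\<in>S. w x * g j x) = 0"
      using j by simp
    then have "\<forall>i\<in>I. (\<Sum>x\<in>S. w x * g i x) = 0"
      using eq by auto
    then show False
      using no[of S w] S w by blast
  qed
qed

section \<open>Linear relations and Caratheodory's theorem for cones\<close>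

text \<open>Gaussian elimination: each equation is used up to eliminate one unknown, and as there
  are more unknowns than equations, one stays free.\<close>

lemma homogeneous_system_nontrivial_solution:
  fixes g :: "'i \<Rightarrow> 'x \<Rightarrow> 'a::field"
  assumes "finite I" "finite S" "card I < card S"
  shows "\<exists>c. (\<exists>x\<in>S. c x \<noteq> 0) \<and> (\<forall>i\<in>I. (\<Sum>x\<in>S. c x * g i x) = 0)"
  using assms
proof (induction I arbitrary: S g rule: finite_induct)
  case empty
  then have "S \<noteq> {}" by auto
  then show ?case by (intro exI[of _ "\<lambda>_. 1"]) auto
next
  case (insert i I)
  show ?case
  proof (cases "\<forall>x\<in>S. g i x = 0")
    case True
    obtain c where "\<exists>x\<in>S. c x \<noteq> 0" "\<forall>i\<in>I. (\<Sum>x\<in>S. c x * g i x) = 0"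
      using insert.IH[of S g] insert.prems insert.hyps by auto
    with True show ?thesis by (intro exI[of _ c]) auto
  next
    case False
    then obtain y where y: "y \<in> S" "g i y \<noteq> 0" by auto
    \<comment> \<open>The row operation that clears column \<open>y\<close>, with pivot
      \<open>g i y\<close>.\<close>
    define g' where "g' j x = g j x - g j y / g i y * g i x" for j x
    have "card I < card (S - {y})"
      using insert.prems insert.hyps y by simp
    then obtain c where c: "\<exists>x\<in>S - {y}. c x \<noteq> 0"
      and eq: "\<forall>j\<in>I. (\<Sum>x\<in>S - {y}. c x * g' j x) = 0"
      using insert.IH[of "S - {y}" g'] insert.prems by auto
    define s where "s = (\<Sum>x\<in>S - {y}. c x * g i x)"
    \<comment> \<open>Back substitution: the value at \<open>y\<close> is the one that solves
      equation \<open>i\<close>.\<close>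
    define c' where "c' = c(y := - s / g i y)"
    have sum': "(\<Sum>x\<in>S. c' x * g j x) = (\<Sum>x\<in>S - {y}. c x * g j x) - s / g i y * g j y" for j
      using y insert.prems(1) by (subst sum.remove[of S y]) (auto simp: c'_def)
    have "(\<Sum>x\<in>S. c' x * g i x) = 0"
      unfolding sum' using y by (simp add: s_def)
    moreover have "(\<Sum>x\<in>S. c' x * g j x) = 0" if "j \<in> I" for j
    proof -
      have "(\<Sum>x\<in>S - {y}. c x * g' j x) = (\<Sum>x\<in>S - {y}. c x * g j x) - g j y / g i y * s"
        by (simp add: g'_def s_def sum_distrib_left sum_subtractf algebra_simps)
      then show ?thesis
        using eq that by (simp add: sum' mult.commute)
    qed
    ultimately show ?thesis
      using c by (intro exI[of _ c']) (auto simp: c'_def)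
  qed
qed

text \<open>As long as there are more points than functions, a linear relation among the value
  vectors allows a shift of the weights that leaves all sums unchanged; the shift is pushed until
  some weight reaches 0, and that point is dropped. The total weight need not be preserved, hence
  the bound \<open>card I\<close> and not \<open>card I + 1\<close>.\<close>

lemma conic_caratheodory:
  fixes g :: "'i \<Rightarrow> 'x \<Rightarrow> real"
  assumes I: "finite I" and "finite S" "\<forall>x\<in>S. 0 \<le> w x"
  shows "\<exists>T u. T \<subseteq> S \<and> card T \<le> card I \<and> (\<forall>x\<in>T. 0 < u x) \<and>
    (\<forall>i\<in>I. (\<Sum>x\<in>T. u x * g i x) = (\<Sum>x\<in>S. w x * g i x))"
  using assms(2,3)
proof (induction "card S" arbitrary: S w rule: less_induct)
  case less
  consider x where "x \<in> S" "w x = 0" | "\<forall>x\<in>S. 0 < w x" "card S \<le> card I"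
    | "\<forall>x\<in>S. 0 < w x" "card I < card S"
    using less.prems
    by (cases "\<exists>x\<in>S. w x = 0"; cases "card S \<le> card I") (auto simp: not_le order.order_iff_strict)
  then show ?case
  proof cases
    case 1
    have drop: "(\<Sum>x\<in>S - {x}. w x * g i x) = (\<Sum>x\<in>S. w x * g i x)" for i
      using 1 less.prems by (intro sum.mono_neutral_left) auto
    have "card (S - {x}) < card S"
      using 1 less.prems by (intro card_Diff1_less)
    then obtain T u where "T \<subseteq> S - {x}" "card T \<le> card I" "\<forall>x\<in>T. 0 < u x"
      "\<forall>i\<in>I. (\<Sum>x\<in>T. u x * g i x) = (\<Sum>x\<in>S - {x}. w x * g i x)"
      using less.hyps[of "S - {x}" w] less.prems by auto
    then show ?thesis
      using drop by (intro exI[of _ T] exI[of _ u]) auto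
  next
    case 2
    then show ?thesis by (intro exI[of _ S] exI[of _ w]) auto
  next
    case 3
    obtain c0 where c0: "\<exists>x\<in>S. c0 x \<noteq> 0" "\<forall>i\<in>I. (\<Sum>x\<in>S. c0 x * g i x) = 0"
      using homogeneous_system_nontrivial_solution[OF I less.prems(1) 3(2)] by blast
    \<comment> \<open>Up to a change of sign the relation has a positive entry, so subtracting
      multiples of it does lower some weight.\<close>
    obtain c where c: "\<exists>x\<in>S. 0 < c x" "\<forall>i\<in>I. (\<Sum>x\<in>S. c x * g i x) = 0"
    proof (cases "\<exists>x\<in>S. 0 < c0 x")
      case True
      then show ?thesis using that[of c0] c0(2) by simp
    next
      case False
      then have "\<exists>x\<in>S. 0 < - c0 x" using c0(1) by force
      moreover have "\<forall>i\<in>I. (\<Sum>x\<in>S. - c0 x * g i x) = 0"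
        using c0(2) by (simp add: sum_negf)
      ultimately show ?thesis using that[of "\<lambda>x. - c0 x"] by simp
    qed
    define P where "P = {x\<in>S. 0 < c x}"
    have P: "finite P" "P \<noteq> {}" using c less.prems by (auto simp: P_def)
    \<comment> \<open>Ratio test: the least quotient \<open>w x / c x\<close> over the positive
      entries is the largest multiple of \<open>c\<close> that can be subtracted with all weights
      staying nonnegative, and it makes the weight at \<open>y\<close> zero.\<close>
    define y where "y = arg_min_on (\<lambda>x. w x / c x) P"
    have y: "y \<in> P"
      unfolding y_def using P by (rule arg_min_if_finite)
    have ymin: "w y / c y \<le> w x / c x" if "x \<in> P" for x
      unfolding y_def using P that by (rule arg_min_least)
    define t where "t = w y / c y"
    define w' where "w' x = w x - t * c x" for x
    have "t > 0" using y 3 by (auto simp: t_def P_def)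
    have yS: "y \<in> S" "w' y = 0" using y by (auto simp: P_def w'_def t_def)
    have nonneg: "0 \<le> w' x" if "x \<in> S" for x
    proof (cases "0 < c x")
      case True
      then show ?thesis
        using ymin[of x] that by (simp add: P_def w'_def t_def pos_le_divide_eq)
    next
      case False
      then have "t * c x \<le> 0" using \<open>t > 0\<close> by (simp add: mult_nonneg_nonpos)
      then show ?thesis using 3(1) that by (auto simp: w'_def intro: order_trans less_imp_le)
    qed
    have same: "(\<Sum>x\<in>S - {y}. w' x * g i x) = (\<Sum>x\<in>S. w x * g i x)" if "i \<in> I" for i
    proof -
      have "(\<Sum>x\<in>S - {y}. w' x * g i x) = (\<Sum>x\<in>S. w' x * g i x)"
        using yS less.prems by (intro sum.mono_neutral_left) auto
      also have "\<dots> = (\<Sum>x\<in>S. w x * g i x) - t * (\<Sum>x\<in>S. c x * g i x)"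
        by (simp add: w'_def sum_distrib_left sum_subtractf algebra_simps)
      finally show ?thesis using c that by simp
    qed
    have "card (S - {y}) < card S"
      using yS less.prems by (intro card_Diff1_less)
    then obtain T u where "T \<subseteq> S - {y}" "card T \<le> card I" "\<forall>x\<in>T. 0 < u x"
      "\<forall>i\<in>I. (\<Sum>x\<in>T. u x * g i x) = (\<Sum>x\<in>S - {y}. w' x * g i x)"
      using less.hyps[of "S - {y}" w'] less.prems nonneg by auto
    then show ?thesis
      using same by (intro exI[of _ T] exI[of _ u]) auto
  qed
qed

section \<open>The closed support, polynomials, and bases of restrictions\<close>

lemma closed_support_eq: "closed_support M = - \<Union>{U. open U \<and> emeasure M U = 0}"
  by (auto simp: closed_support_def zero_less_iff_neq_zero)

lemma closed_closed_support: "closed (closed_support M)"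
  by (auto simp: closed_support_eq)

text \<open>The complement of the support is a union of possibly uncountably many open null sets; by
  Lindelof's theorem countably many of them already cover it.\<close>

lemma AE_closed_support:
  fixes M :: "'a::second_countable_topology measure"
  assumes "sets M = sets borel"
  shows "AE x in M. x \<in> closed_support M"
proof -
  obtain F where F: "F \<subseteq> {U. open U \<and> emeasure M U = 0}" "countable F"
    and eq: "\<Union>F = \<Union>{U. open U \<and> emeasure M U = 0}"
    using Lindelof[of "{U. open U \<and> emeasure M U = 0}"] by auto
  have "(\<Union>U\<in>F. U) \<in> null_sets M"
    using F assms by (intro null_sets_UN') (auto intro!: null_setsI)
  then show ?thesis
    by (rule AE_I') (use eq in \<open>auto simp: closed_support_eq\<close>)
qed

lemma finite_exponents: "finite {a :: 'd::finite \<Rightarrow> nat. sum a UNIV \<le> m}"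
proof -
  have "a i \<le> sum a UNIV" for a :: "'d \<Rightarrow> nat" and i
    by (rule member_le_sum) auto
  then have "{a :: 'd \<Rightarrow> nat. sum a UNIV \<le> m} \<subseteq> PiE UNIV (\<lambda>_. {..m})"
    by (auto intro: order_trans)
  then show ?thesis
    by (rule finite_subset) (intro finite_PiE; simp)
qed

lemma polys_upto_mono:
  assumes "m \<le> n"
  shows "polys_upto m \<subseteq> (polys_upto n :: (real ^ 'd::finite \<Rightarrow> real) set)"
proof
  fix p :: "real ^ 'd \<Rightarrow> real"
  assume "p \<in> polys_upto m"
  then obtain c where c: "p = (\<lambda>t. \<Sum>a | sum a UNIV \<le> m. c a * monomial_fun a t)"
    by (auto simp: polys_upto_def)
  have "p = (\<lambda>t. \<Sum>a | sum a UNIV \<le> n. (if sum a UNIV \<le> m then c a else 0) * monomial_fun a t)"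
    unfolding c using assms finite_exponents[of n]
    by (intro ext sum.mono_neutral_cong_left) auto
  then show "p \<in> polys_upto n"
    unfolding polys_upto_def
    by (intro CollectI exI[of _ "\<lambda>a. if sum a UNIV \<le> m then c a else 0"])
qed

text \<open>Together with the moment hypothesis this makes the constant 1 integrable, so
  \<open>M\<close> is finite.\<close>

lemma one_in_polys_upto: "(\<lambda>t :: real ^ 'd::finite. 1) \<in> polys_upto m"
proof -
  have "(\<Sum>a | sum a UNIV \<le> m. (if a = (\<lambda>_. 0) then 1 else 0) * monomial_fun a t) = 1"
    for t :: "real ^ 'd"
  proof -
    have "(\<Sum>a | sum a UNIV \<le> m. (if a = (\<lambda>_. 0) then 1 else 0) * monomial_fun a t)
        = (\<Sum>a\<in>{a :: 'd \<Rightarrow> nat. sum a UNIV \<le> m}. if a = (\<lambda>_. 0) then 1 else 0)"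
      by (intro sum.cong) (auto simp: monomial_fun_def)
    then show ?thesis
      using finite_exponents[of m, where ?'d = 'd] by simp
  qed
  then show ?thesis
    unfolding polys_upto_def by (intro CollectI exI[of _ "\<lambda>a. if a = (\<lambda>_. 0) then 1 else 0"]) simp
qed

lemma sum_fun_apply: "(\<Sum>a\<in>A. f a) x = (\<Sum>a\<in>A. f a x)" for f :: "_ \<Rightarrow> _ \<Rightarrow> 'b::comm_monoid_add"
  by (induction A rule: infinite_finite_induct) auto

text \<open>The restricted monomials are finitely many and span all restrictions, so an independent
  set of restrictions is finite. The equation for \<open>card B\<close> alone would not show this,
  as \<open>card\<close> is 0 on infinite sets.\<close>

lemma restriction_basis:
  fixes M :: "(real ^ 'd::finite) measure"
  obtains B where "finite B" "card B = restriction_dim m M"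
    "B \<subseteq> (\<lambda>p x. if x \<in> closed_support M then p x else 0) ` polys_upto m"
    "\<And>p. p \<in> polys_upto m \<Longrightarrow> \<exists>u. \<forall>x\<in>closed_support M. p x = (\<Sum>b\<in>B. u b * b x)"
proof -
  define r where "r p x = (if x \<in> closed_support M then p x else 0)" for p :: "real ^ 'd \<Rightarrow> real" and x
  define mons where "mons = (\<lambda>a. r (monomial_fun a)) ` {a :: 'd \<Rightarrow> nat. sum a UNIV \<le> m}"
  have "r ` polys_upto m \<subseteq> real_fun.span mons"
  proof
    fix f assume "f \<in> r ` polys_upto m"
    then obtain c where c: "f = r (\<lambda>t. \<Sum>a | sum a UNIV \<le> m. c a * monomial_fun a t)"
      by (auto simp: polys_upto_def)
    have "f = (\<Sum>a | sum a UNIV \<le> m. (\<lambda>x. c a * r (monomial_fun a) x))"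
      by (auto simp: c r_def sum_fun_apply fun_eq_iff)
    also have "\<dots> \<in> real_fun.span mons"
      by (intro real_fun.span_sum real_fun.span_scale real_fun.span_base) (auto simp: mons_def)
    finally show "f \<in> real_fun.span mons" .
  qed
  moreover have "finite mons"
    unfolding mons_def using finite_exponents by auto
  moreover obtain B where B: "B \<subseteq> r ` polys_upto m" "real_fun.independent B"
    "r ` polys_upto m \<subseteq> real_fun.span B" "card B = real_fun.dim (r ` polys_upto m)"
    using real_fun.basis_exists by blast
  ultimately have "finite B"
    using real_fun.independent_span_bound[of mons B] by auto
  show ?thesis
  proof
    show "finite B" by fact
    show "card B = restriction_dim m M"
      using B(4) by (simp add: restriction_dim_def r_def[abs_def])
    show "B \<subseteq> (\<lambda>p x. if x \<in> closed_support M then p x else 0) ` polys_upto m"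
      using B(1) by (simp add: r_def[abs_def])
    fix p :: "real ^ 'd \<Rightarrow> real"
    assume "p \<in> polys_upto m"
    then have "r p \<in> real_fun.span B" using B(3) by auto
    then obtain u where "r p = (\<Sum>b\<in>B. (\<lambda>x. u b * b x))"
      using real_fun.span_finite[OF \<open>finite B\<close>] by auto
    then have "r p x = (\<Sum>b\<in>B. u b * b x)" for x
      by (simp add: sum_fun_apply)
    then have "p x = (\<Sum>b\<in>B. u b * b x)" if "x \<in> closed_support M" for x
      using that unfolding r_def by metis
    then show "\<exists>u. \<forall>x\<in>closed_support M. p x = (\<Sum>b\<in>B. u b * b x)"
      by blast
  qed
qed

section \<open>Positive representations and the quadrature rule\<close>

text \<open>For a nonzero measure, convex weights that annihilate the centred functions become
  weights reproducing the integrals once multiplied by the total mass \<open>V\<close>.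
  Caratheodory's theorem then thins out the points.\<close>

lemma finite_positive_representation:
  fixes M :: "'x measure" and B :: "('x \<Rightarrow> real) set"
  assumes "finite B" and int: "\<And>b. b \<in> B \<Longrightarrow> integrable M b"
    and one: "integrable M (\<lambda>x. 1 :: real)" and K: "AE x in M. x \<in> K"
  shows "\<exists>T w. finite T \<and> T \<subseteq> K \<and> card T \<le> card B \<and> (\<forall>x\<in>T. 0 < w x) \<and>
    (\<forall>b\<in>B. (\<integral>x. b x \<partial>M) = (\<Sum>x\<in>T. w x * b x))"
proof (cases "AE x in M. False")
  \<comment> \<open>The zero measure: all integrals vanish, and the empty set of nodes represents
    them.\<close>
  case True
  then have "(\<integral>x. b x \<partial>M) = 0" for b :: "'x \<Rightarrow> real"
    by (intro integral_eq_zero_AE) auto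
  then show ?thesis by (intro exI[of _ "{}"]) auto
next
  case False
  define V where "V = (\<integral>x. (1 :: real) \<partial>M)"
  have "V \<noteq> 0"
    using integral_nonneg_eq_0_iff_AE[OF one] False by (simp add: V_def)
  moreover have "V \<ge> 0"
    by (simp add: V_def)
  ultimately have V: "V > 0" by simp
  \<comment> \<open>Writing \<open>* 1\<close> keeps the subtracted mean a multiple of the constant
    function 1, whose integral is \<open>V\<close>.\<close>
  define g where "g b x = b x - (\<integral>y. b y \<partial>M) / V * 1" for b :: "'x \<Rightarrow> real" and x
  have "integrable M (g b)" "(\<integral>x. g b x \<partial>M) = 0" if "b \<in> B" for b
  proof -
    have c: "integrable M (\<lambda>x. (\<integral>y. b y \<partial>M) / V * 1)"
      using one by (rule integrable_mult_right)
    show "integrable M (g b)"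
      unfolding g_def[abs_def] using int[OF that] c by (rule Bochner_Integration.integrable_diff)
    have "(\<integral>x. g b x \<partial>M) = (\<integral>x. b x \<partial>M) - (\<integral>x. (\<integral>y. b y \<partial>M) / V * 1 \<partial>M)"
      unfolding g_def using int[OF that] c by (rule Bochner_Integration.integral_diff)
    also have "(\<integral>x. (\<integral>y. b y \<partial>M) / V * 1 \<partial>M) = (\<integral>y. b y \<partial>M) / V * V"
      unfolding V_def by (rule integral_mult_right_zero)
    finally show "(\<integral>x. g b x \<partial>M) = 0"
      using V by simp
  qed
  then obtain S w where S: "finite S" "S \<subseteq> K" and w: "\<forall>x\<in>S. 0 \<le> w x" "sum w S = 1"
    and eq: "\<forall>b\<in>B. (\<Sum>x\<in>S. w x * g b x) = 0"
    using zero_mean_imp_convex_combination[OF \<open>finite B\<close>, of M g K] K False by blast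
  have rep: "(\<Sum>x\<in>S. (V * w x) * b x) = (\<integral>x. b x \<partial>M)" if "b \<in> B" for b
  proof -
    have "0 = (\<Sum>x\<in>S. w x * b x) - (\<Sum>x\<in>S. w x) * ((\<integral>y. b y \<partial>M) / V)"
      using eq that by (simp add: g_def right_diff_distrib sum_subtractf flip: sum_distrib_right sum_divide_distrib)
    then have "(\<integral>x. b x \<partial>M) = V * (\<Sum>x\<in>S. w x * b x)"
      using w V by (simp add: field_simps)
    then show ?thesis
      by (simp add: sum_distrib_left mult.assoc)
  qed
  have "\<forall>x\<in>S. 0 \<le> V * w x"
    using w V by simp
  \<comment> \<open>The functions in \<open>B\<close> serve as their own indices.\<close>
  from conic_caratheodory[OF \<open>finite B\<close> \<open>finite S\<close> this, of "\<lambda>b. b"]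
  obtain T u where "T \<subseteq> S" "card T \<le> card B" "\<forall>x\<in>T. 0 < u x"
    "\<forall>b\<in>B. (\<Sum>x\<in>T. u x * b x) = (\<Sum>x\<in>S. (V * w x) * b x)"
    by blast
  then show ?thesis
    using rep S by (intro exI[of _ T] exI[of _ u]) (auto intro: finite_subset)
qed

theorem theorem1p4:
  fixes M :: "(real ^ 'd::finite) measure" and n :: nat
  assumes "n \<ge> 1"
    and "sets M = sets borel"
    and "\<And>p. p \<in> polys_upto n \<Longrightarrow> integrable M p"
  shows "\<exists>N x \<rho>. N \<le> 1 + restriction_dim (n - 1) M \<and> quadrature_rule M (n - 1) N x \<rho>"
proof -
  define K where "K = closed_support M"
  have int: "integrable M p" if "p \<in> polys_upto (n - 1)" for p
    using polys_upto_mono[of "n - 1" n] that assms(3) by auto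
  obtain B where B: "finite B" "card B = restriction_dim (n - 1) M"
    "B \<subseteq> (\<lambda>p x. if x \<in> K then p x else 0) ` polys_upto (n - 1)"
    and span: "\<And>p. p \<in> polys_upto (n - 1) \<Longrightarrow> \<exists>u. \<forall>x\<in>K. p x = (\<Sum>b\<in>B. u b * b x)"
    unfolding K_def using restriction_basis by blast
  have "K \<in> sets M"
    unfolding K_def assms(2) by (intro borel_closed closed_closed_support)
  \<comment> \<open>Extension by zero is multiplication by the indicator of \<open>K\<close>, which
    is measurable because the support is closed.\<close>
  have intB: "integrable M b" if "b \<in> B" for b
  proof -
    obtain p where p: "p \<in> polys_upto (n - 1)" "b = (\<lambda>x. if x \<in> K then p x else 0)"
      using subsetD[OF B(3) \<open>b \<in> B\<close>] by blast
    have "b = (\<lambda>x. indicator K x *\<^sub>R p x)"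
      by (auto simp: p)
    then show ?thesis
      using integrable_mult_indicator[OF \<open>K \<in> sets M\<close> int[OF p(1)]] by simp
  qed
  have AE_K: "AE x in M. x \<in> K"
    unfolding K_def using assms(2) by (rule AE_closed_support)
  obtain T w where T: "finite T" "T \<subseteq> K" "card T \<le> card B" and w: "\<forall>x\<in>T. 0 < w x"
    and rep: "\<forall>b\<in>B. (\<integral>x. b x \<partial>M) = (\<Sum>x\<in>T. w x * b x)"
    using finite_positive_representation[OF B(1) intB assms(3)[OF one_in_polys_upto] AE_K] by blast
  \<comment> \<open>The expansion of \<open>p\<close> in \<open>B\<close> is valid only on
    \<open>K\<close>. That suffices on both sides: almost every point lies in \<open>K\<close>, and
    so does every node.\<close>
  have exact: "(\<integral>x. p x \<partial>M) = (\<Sum>x\<in>T. w x * p x)" if p: "p \<in> polys_upto (n - 1)" for p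
  proof -
    obtain u where u: "\<And>x. x \<in> K \<Longrightarrow> p x = (\<Sum>b\<in>B. u b * b x)"
      using span[OF p] by blast
    have "(\<integral>x. p x \<partial>M) = (\<integral>x. (\<Sum>b\<in>B. u b * b x) \<partial>M)"
    proof (rule integral_cong_AE)
      show "p \<in> borel_measurable M" "(\<lambda>x. \<Sum>b\<in>B. u b * b x) \<in> borel_measurable M"
        using int[OF p] intB by (auto intro!: borel_measurable_integrable)
      show "AE x in M. p x = (\<Sum>b\<in>B. u b * b x)"
        using AE_K by eventually_elim (rule u)
    qed
    also have "\<dots> = (\<Sum>b\<in>B. u b * (\<Sum>x\<in>T. w x * b x))"
      using intB rep by (simp add: Bochner_Integration.integral_sum)
    also have "\<dots> = (\<Sum>x\<in>T. w x * (\<Sum>b\<in>B. u b * b x))"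
      unfolding sum_distrib_left by (subst sum.swap) (simp add: mult.left_commute)
    also have "\<dots> = (\<Sum>x\<in>T. w x * p x)"
      using T(2) by (intro sum.cong) (auto simp: u)
    finally show ?thesis .
  qed
  \<comment> \<open>The nodes are numbered from 1, to match the range \<open>{1..N}\<close> in
    \<open>quadrature_rule\<close>.\<close>
  obtain h where h: "bij_betw h {1..card T} T"
    using ex_bij_betw_nat_finite_1[OF T(1)] by blast
  have "(\<Sum>k=1..card T. w (h k) * p (h k)) = (\<Sum>x\<in>T. w x * p x)" for p
    using sum.reindex_bij_betw[OF h, of "\<lambda>x. w x * p x"] .
  then have "quadrature_rule M (n - 1) (card T) h (w \<circ> h)"
    unfolding quadrature_rule_def using bij_betwE[OF h] T(2) w int exact by (auto simp: K_def)
  moreover have "card T \<le> 1 + restriction_dim (n - 1) M"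
    using T(3) B(2) by simp
  ultimately show ?thesis by blast
qed

end
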